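(* There is an absolute constant $C>0$ such that the following holds. Let $\mathcal L$ be a finite set of curves in $\mathbb R^2$ and $\mathcal P$ a finite set of points in $\mathbb R^2$ forming a simple intersection arrangement, i.e. any two distinct curves of $\mathcal L$ have at most one common point of $\mathcal P$, and any two distinct points of $\mathcal P$ lie on at most one common curve of $\mathcal L$. Let $\mu,\nu\geq 1$ be integers, and assign to each $l\in\mathcal L$ a weight $\mu(l)\in\{1,\dots,\mu\}$ and to each $p\in\mathcal P$ a weight $\nu(p)\in\{1,\dots,\nu\}$, with net weights $m=\sum_{l\in\mathcal L}\mu(l)$ and $n=\sum_{p\in\mathcal P}\nu(p)$. Define the number of weighted incidences $$I=\sum_{l\in\mathcal L,\,p\in\mathcal P}\mu(l)\nu(p)\delta_{lp},$$ where $\delta_{lp}=1$ if $p\in l$ and $0$ otherwise. Then $$I\leq C\left((\mu\nu)^{1/3}(mn)^{2/3}+\nu m+\mu n\right).$$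
   Context: The curves are assumed to be of the type for which the Szemerédi–Trotter incidence bound holds in Székely's form (e.g. lines, or translates of the graph of a strictly convex function): for $m'$ such curves and $n'$ points in a simple intersection arrangement, the number of incidences is at most a constant times $(m'n')^{2/3}+m'+n'$. *)

theory Defs
  imports "HOL-Analysis.Analysis"
begin

definition plane_curve :: "(real^2) set \<Rightarrow> bool" where
  "plane_curve c \<longleftrightarrow>
     (\<exists>(S :: real set) g. is_interval S \<and> S \<noteq> {} \<and> continuous_on S g \<and> c = g ` S)"

definition simple_arrangement :: "(real^2) set set \<Rightarrow> (real^2) set \<Rightarrow> bool" where
  "simple_arrangement L P \<longleftrightarrow>
     (\<forall>l\<in>L. \<forall>l'\<in>L. l \<noteq> l' \<longrightarrow> (\<exists>\<^sub>\<le>\<^sub>1 p. p \<in> P \<and> p \<in> l \<and> p \<in> l')) \<and>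
     (\<forall>p\<in>P. \<forall>q\<in>P. p \<noteq> q \<longrightarrow> (\<exists>\<^sub>\<le>\<^sub>1 l. l \<in> L \<and> p \<in> l \<and> q \<in> l))"

definition incidences :: "(real^2) set set \<Rightarrow> (real^2) set \<Rightarrow> nat" where
  "incidences L P = card {(l, p). l \<in> L \<and> p \<in> P \<and> p \<in> l}"

(* The admissible type of curves is a family Cs, such as all lines or all translates of one
   strictly convex graph. The constant K is kept explicit so that later constants can be seen
   to depend on K alone and not on Cs. *)
definition szemeredi_trotter :: "real \<Rightarrow> (real^2) set set \<Rightarrow> bool" where
  "szemeredi_trotter K Cs \<longleftrightarrow>
     (\<forall>L P. finite L \<and> L \<subseteq> Cs \<and> finite P \<and> simple_arrangement L P \<longrightarrow>
        real (incidences L P) \<le>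
          K * ((real (card L) * real (card P)) powr (2/3) + real (card L) + real (card P)))"

definition weighted_incidences ::
  "((real^2) set \<Rightarrow> nat) \<Rightarrow> (real^2 \<Rightarrow> nat) \<Rightarrow> (real^2) set set \<Rightarrow> (real^2) set \<Rightarrow> nat" where
  "weighted_incidences wl wp L P = (\<Sum>l\<in>L. \<Sum>p\<in>P. wl l * wp p * of_bool (p \<in> l))"

end

(* Layer-cake decomposition: the weighted incidence count is the sum, over all pairs of levels
   i \<le> \<mu> and j \<le> \<nu>, of the unweighted incidences between the curves of weight at least i and the
   points of weight at least j. The sizes of these level sets add up to the net weights m and n, so
   summing the unweighted bounds gives \<nu> m + \<mu> n for the linear terms, and concavity of x powr (2/3)
   gives (\<mu> \<nu>)^(1/3) (m n)^(2/3) for the main term. The constant is K itself. *)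

theory Submission imports Defs begin

text \<open>Jensen's inequality for the concave function x powr \<alpha>, obtained by adding up
  weighted AM-GM (Young) inequalities that compare each term with the mean.\<close>

lemma sum_powr_le:
  fixes a :: "'a \<Rightarrow> real"
  assumes "\<And>i. i \<in> A \<Longrightarrow> 0 \<le> a i" "0 \<le> \<alpha>" "\<alpha> \<le> 1"
  shows "(\<Sum>i\<in>A. a i powr \<alpha>) \<le> real (card A) powr (1 - \<alpha>) * (\<Sum>i\<in>A. a i) powr \<alpha>"
proof (cases "finite A \<and> (\<Sum>i\<in>A. a i) \<noteq> 0")
  case True
  define S where "S = (\<Sum>i\<in>A. a i)"
  define N where "N = real (card A)"
  \<comment> \<open>The mean of the \<open>a i\<close>. Multiplying by
    \<open>t powr (1 - \<alpha>)\<close> puts every summand in the form of Young's inequality, which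
    is an equality when \<open>a i = t\<close>.\<close>
  define t where "t = S / N"
  have fin: "finite A" and "A \<noteq> {}" using True by auto
  then have N: "N > 0" by (simp add: N_def card_gt_0_iff)
  have S: "S > 0" using True assms(1) sum_nonneg[of A a] by (fastforce simp: S_def)
  have t: "t > 0" using S N by (simp add: t_def)
  have "(\<Sum>i\<in>A. a i powr \<alpha>) * t powr (1 - \<alpha>) = (\<Sum>i\<in>A. a i powr \<alpha> * t powr (1 - \<alpha>))"
    by (rule sum_distrib_right)
  also have "\<dots> \<le> (\<Sum>i\<in>A. \<alpha> * a i + (1 - \<alpha>) * t)"
  proof (rule sum_mono)
    fix i assume "i \<in> A"
    show "a i powr \<alpha> * t powr (1 - \<alpha>) \<le> \<alpha> * a i + (1 - \<alpha>) * t"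
    \<comment> \<open>Young's inequality is applied to positive numbers only; at zero the left side
      vanishes, as \<open>0 powr \<alpha> = 0\<close> even for \<alpha> = 0.\<close>
    proof (cases "a i = 0")
      case False
      then show ?thesis
        using assms(1)[OF \<open>i \<in> A\<close>] assms(2,3) t by (intro Youngs_inequality_0) auto
    qed (use assms(3) t in auto)
  qed
  also have "\<dots> = \<alpha> * S + (1 - \<alpha>) * (N * t)"
    by (simp add: sum.distrib sum_distrib_left S_def N_def)
  also have "\<dots> = S"
    using N by (simp add: t_def algebra_simps)
  \<comment> \<open>Since \<open>t = S / N\<close>, the powers of \<open>N\<close> cancel and the
    exponents of \<open>S\<close> add up to 1. Cancelling the positive factor
    \<open>t powr (1 - \<alpha>)\<close> then finishes.\<close>
  also have "\<dots> = N powr (1 - \<alpha>) * S powr \<alpha> * t powr (1 - \<alpha>)"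
    using S N by (simp add: t_def powr_divide flip: powr_add)
  finally show ?thesis
    using t by (simp add: S_def N_def)
next
  case False
  then show ?thesis
  proof (cases "finite A")
    case True
    then have "\<forall>i\<in>A. a i = 0" using False assms(1) by (simp add: sum_nonneg_eq_0_iff)
    then show ?thesis by simp
  qed simp
qed

text \<open>Cutting off at a common bound \<open>N\<close> makes the range of levels independent of
  the element whose weight is expanded, so that sums can be interchanged.\<close>

lemma nat_eq_sum_levels:
  fixes k :: nat
  assumes "k \<le> N"
  shows "k = (\<Sum>i=1..N. of_bool (i \<le> k))"
proof -
  have "{1..N} \<inter> {i. i \<le> k} = {1..k}" using assms by auto
  then show ?thesis by simp
qed

lemma sum_eq_sum_card_levels:
  fixes w :: "'a \<Rightarrow> nat"
  assumes "finite A" "\<And>x. x \<in> A \<Longrightarrow> w x \<le> N"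
  shows "(\<Sum>x\<in>A. w x) = (\<Sum>i=1..N. card {x\<in>A. i \<le> w x})"
proof -
  have "(\<Sum>x\<in>A. w x) = (\<Sum>x\<in>A. \<Sum>i=1..N. of_bool (i \<le> w x))"
    by (intro sum.cong refl nat_eq_sum_levels assms(2))
  also have "\<dots> = (\<Sum>i=1..N. \<Sum>x\<in>A. of_bool (i \<le> w x))"
    by (rule sum.swap)
  finally show ?thesis using assms(1) by (simp add: Int_def)
qed

text \<open>This lets the unweighted bound be applied to every pair of level sets.\<close>

lemma simple_arrangement_subset:
  assumes "simple_arrangement L P" "L' \<subseteq> L" "P' \<subseteq> P"
  shows "simple_arrangement L' P'"
  using assms unfolding simple_arrangement_def Uniq_def by (meson subsetD)

lemma incidences_eq_sum:
  assumes "finite L" "finite P"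
  shows "incidences L P = (\<Sum>l\<in>L. \<Sum>p\<in>P. of_bool (p \<in> l))"
proof -
  have "{(l, p). l \<in> L \<and> p \<in> P \<and> p \<in> l} = (SIGMA l:L. {p\<in>P. p \<in> l})"
    by auto
  then show ?thesis
    using assms by (simp add: incidences_def Int_def)
qed

lemma weighted_incidences_eq_sum_levels:
  assumes "finite L" "finite P"
    and "\<And>l. l \<in> L \<Longrightarrow> wl l \<le> \<mu>" "\<And>p. p \<in> P \<Longrightarrow> wp p \<le> \<nu>"
  shows "weighted_incidences wl wp L P =
    (\<Sum>i=1..\<mu>. \<Sum>j=1..\<nu>. incidences {l\<in>L. i \<le> wl l} {p\<in>P. j \<le> wp p})"
proof -
  have "weighted_incidences wl wp L P =
    (\<Sum>l\<in>L. \<Sum>p\<in>P. \<Sum>i=1..\<mu>. \<Sum>j=1..\<nu>. of_bool (i \<le> wl l \<and> j \<le> wp p \<and> p \<in> l))"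
    unfolding weighted_incidences_def
  proof (intro sum.cong refl)
    fix l p assume "l \<in> L" "p \<in> P"
    then have wl: "wl l = (\<Sum>i=1..\<mu>. of_bool (i \<le> wl l))"
      and wp: "wp p = (\<Sum>j=1..\<nu>. of_bool (j \<le> wp p))"
      by (blast intro: nat_eq_sum_levels assms(3,4))+
    show "wl l * wp p * of_bool (p \<in> l) =
      (\<Sum>i=1..\<mu>. \<Sum>j=1..\<nu>. of_bool (i \<le> wl l \<and> j \<le> wp p \<and> p \<in> l))"
      \<comment> \<open>The equations \<open>wl\<close> and \<open>wp\<close> contain their left
        sides again on the right, so each is used for a single rewrite.\<close>
      by (subst wl, subst wp, subst sum_product)
        (simp only: sum_distrib_right of_bool_conj mult.assoc)
  qed
  also have "\<dots> = (\<Sum>l\<in>L. \<Sum>i=1..\<mu>. \<Sum>j=1..\<nu>. \<Sum>p\<in>P.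
      of_bool (i \<le> wl l \<and> j \<le> wp p \<and> p \<in> l))"
    \<comment> \<open>Fixing both index sets orients the swap: level sums only move outwards, first
      past \<open>P\<close> and then past \<open>L\<close>.\<close>
    by (simp only: sum.swap[of _ "{1..\<mu>}" P] sum.swap[of _ "{1..\<nu>}" P])
  also have "\<dots> = (\<Sum>i=1..\<mu>. \<Sum>j=1..\<nu>. \<Sum>l\<in>L. \<Sum>p\<in>P.
      of_bool (i \<le> wl l \<and> j \<le> wp p \<and> p \<in> l))"
    by (simp only: sum.swap[of _ "{1..\<mu>}" L] sum.swap[of _ "{1..\<nu>}" L])
  also have "\<dots> = (\<Sum>i=1..\<mu>. \<Sum>j=1..\<nu>. incidences {l\<in>L. i \<le> wl l} {p\<in>P. j \<le> wp p})"
  proof (intro sum.cong refl)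
    fix i j
    show "(\<Sum>l\<in>L. \<Sum>p\<in>P. of_bool (i \<le> wl l \<and> j \<le> wp p \<and> p \<in> l)) =
      incidences {l\<in>L. i \<le> wl l} {p\<in>P. j \<le> wp p}"
      using assms(1,2)
      by (auto simp: incidences_eq_sum sum.inter_filter intro!: sum.cong arg_cong[of _ _ card])
  qed
  finally show ?thesis .
qed

lemma weighted_szemeredi_trotter:
  assumes ST: "szemeredi_trotter K Cs" and "K \<ge> 0"
    and L: "finite L" "L \<subseteq> Cs" and P: "finite P" and LP: "simple_arrangement L P"
    and wl: "\<And>l. l \<in> L \<Longrightarrow> wl l \<le> \<mu>" and wp: "\<And>p. p \<in> P \<Longrightarrow> wp p \<le> \<nu>"
  defines "m \<equiv> (\<Sum>l\<in>L. wl l)" and "n \<equiv> (\<Sum>p\<in>P. wp p)"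
  shows "real (weighted_incidences wl wp L P) \<le>
    K * ((real \<mu> * real \<nu>) powr (1/3) * (real m * real n) powr (2/3)
         + real \<nu> * real m + real \<mu> * real n)"
proof -
  define a where "a i = real (card {l\<in>L. i \<le> wl l})" for i
  define b where "b j = real (card {p\<in>P. j \<le> wp p})" for j
  have m: "real m = (\<Sum>i=1..\<mu>. a i)" and n: "real n = (\<Sum>j=1..\<nu>. b j)"
    unfolding m_def n_def a_def b_def
    using sum_eq_sum_card_levels[of L wl \<mu>] sum_eq_sum_card_levels[of P wp \<nu>] L P wl wp
    by simp_all
  \<comment> \<open>There are \<mu> levels, so concavity with exponent 2/3 costs the factor \<mu>
    powr (1 - 2/3).\<close>
  have a: "(\<Sum>i=1..\<mu>. a i powr (2/3)) \<le> real \<mu> powr (1/3) * real m powr (2/3)"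
    using sum_powr_le[of "{1..\<mu>}" a "2/3"] by (simp add: a_def m)
  have b: "(\<Sum>j=1..\<nu>. b j powr (2/3)) \<le> real \<nu> powr (1/3) * real n powr (2/3)"
    using sum_powr_le[of "{1..\<nu>}" b "2/3"] by (simp add: b_def n)
  \<comment> \<open>The main term separates into a curve factor and a point factor, so concavity is
    used once for each.\<close>
  have prod: "(\<Sum>i=1..\<mu>. \<Sum>j=1..\<nu>. (a i * b j) powr (2/3)) =
      (\<Sum>i=1..\<mu>. a i powr (2/3)) * (\<Sum>j=1..\<nu>. b j powr (2/3))"
    by (simp add: sum_product powr_mult a_def b_def)
  have "real (weighted_incidences wl wp L P) =
      (\<Sum>i=1..\<mu>. \<Sum>j=1..\<nu>. real (incidences {l\<in>L. i \<le> wl l} {p\<in>P. j \<le> wp p}))"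
    using weighted_incidences_eq_sum_levels[OF L(1) P wl wp] by simp
  also have "\<dots> \<le> (\<Sum>i=1..\<mu>. \<Sum>j=1..\<nu>. K * ((a i * b j) powr (2/3) + a i + b j))"
  proof (intro sum_mono)
    fix i j
    have "simple_arrangement {l\<in>L. i \<le> wl l} {p\<in>P. j \<le> wp p}"
      using LP by (rule simple_arrangement_subset) auto
    moreover have "{l\<in>L. i \<le> wl l} \<subseteq> Cs" using L(2) by auto
    ultimately show "real (incidences {l\<in>L. i \<le> wl l} {p\<in>P. j \<le> wp p}) \<le>
        K * ((a i * b j) powr (2/3) + a i + b j)"
      using ST L(1) P unfolding szemeredi_trotter_def a_def b_def by simp
  qed
  also have "\<dots> = K * ((\<Sum>i=1..\<mu>. \<Sum>j=1..\<nu>. (a i * b j) powr (2/3))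
      + (\<Sum>i=1..\<mu>. \<Sum>j=1..\<nu>. a i) + (\<Sum>i=1..\<mu>. \<Sum>j=1..\<nu>. b j))"
    by (simp only: sum_distrib_left[symmetric] sum.distrib)
  \<comment> \<open>Each \<open>a i\<close> is counted once per point level and each
    \<open>b j\<close> once per curve level, hence the crossed factors \<nu> m and \<mu> n.\<close>
  also have "\<dots> = K * ((\<Sum>i=1..\<mu>. a i powr (2/3)) * (\<Sum>j=1..\<nu>. b j powr (2/3))
      + real \<nu> * real m + real \<mu> * real n)"
    unfolding prod by (simp add: m n sum_distrib_left)
  also have "\<dots> \<le> K * ((real \<mu> powr (1/3) * real m powr (2/3)) * (real \<nu> powr (1/3) * real n powr (2/3))
      + real \<nu> * real m + real \<mu> * real n)"
    using \<open>K \<ge> 0\<close> by (intro mult_left_mono add_mono mult_mono a b) (auto intro: sum_nonneg)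
  finally show ?thesis
    by (simp add: powr_mult mult_ac)
qed

theorem mainTheorem3:
  fixes K :: real
  assumes "K > 0"
  shows "\<exists>C::real. C > 0 \<and>
    (\<forall>(Cs :: (real^2) set set) (L :: (real^2) set set) (P :: (real^2) set)
       (\<mu> :: nat) (\<nu> :: nat) (wl :: (real^2) set \<Rightarrow> nat) (wp :: real^2 \<Rightarrow> nat) (m :: nat) (n :: nat).
       (\<forall>c\<in>Cs. plane_curve c) \<and> szemeredi_trotter K Cs \<and>
       finite L \<and> L \<subseteq> Cs \<and> finite P \<and> simple_arrangement L P \<and>
       \<mu> \<ge> 1 \<and> \<nu> \<ge> 1 \<and>
       (\<forall>l\<in>L. wl l \<in> {1..\<mu>}) \<and> (\<forall>p\<in>P. wp p \<in> {1..\<nu>}) \<and>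
       m = (\<Sum>l\<in>L. wl l) \<and> n = (\<Sum>p\<in>P. wp p) \<longrightarrow>
       real (weighted_incidences wl wp L P) \<le>
         C * ((real \<mu> * real \<nu>) powr (1/3) * (real m * real n) powr (2/3)
              + real \<nu> * real m + real \<mu> * real n))"
proof (intro exI[of _ K] conjI allI impI; (elim conjE)?)
  show "K > 0" by (rule assms)
next
  fix Cs L P and \<mu> \<nu> m n :: nat and wl :: "(real^2) set \<Rightarrow> nat" and wp :: "real^2 \<Rightarrow> nat"
  assume "szemeredi_trotter K Cs" "finite L" "L \<subseteq> Cs" "finite P" "simple_arrangement L P"
    and "\<forall>l\<in>L. wl l \<in> {1..\<mu>}" "\<forall>p\<in>P. wp p \<in> {1..\<nu>}"
    and mn: "m = (\<Sum>l\<in>L. wl l)" "n = (\<Sum>p\<in>P. wp p)"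
  then show "real (weighted_incidences wl wp L P) \<le>
    K * ((real \<mu> * real \<nu>) powr (1/3) * (real m * real n) powr (2/3)
         + real \<nu> * real m + real \<mu> * real n)"
    unfolding mn using assms by (intro weighted_szemeredi_trotter) auto
qed

end
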